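(* Let $X$ and $Y$ be metric spaces and let $f\colon X\to Y$ be a continuous function. Then: (i) $\ell(f)$ is a $G_{\delta\sigma}$-set; (ii) $\ell^\infty(f)$ is an $F_{\sigma\delta}$-set; (iii) $L(f)$ is an $F_\sigma$-set; (iv) $L^\infty(f)$ is a $G_\delta$-set.
   Context: The metric on a metric space $X$ is written $|\cdot-\cdot|_X$, and $B(x,r)=\{u\in X: |u-x|_X<r\}$. For $f\colon X\to Y$ and $x\in X$ (with the convention $\sup\varnothing=0$), the big Lipschitz derivative is $\operatorname{Lip} f(x)=\limsup_{u\to x}\frac{|f(u)-f(x)|_Y}{|u-x|_X}=\inf_{r>0}\sup_{0<|u-x|_X<r}\frac{|f(u)-f(x)|_Y}{|u-x|_X}$ and the little Lipschitz derivative is $\operatorname{lip} f(x)=\liminf_{r\to0^+}\sup_{u\in B(x,r)}\frac1r|f(u)-f(x)|_Y$. Both take values in $[0,+\infty]$. Denote $\ell(f)=\{x\in X:\operatorname{lip} f(x)<\infty\}$, $\ell^\infty(f)=\{x\in X:\operatorname{lip} f(x)=\infty\}$, $L(f)=\{x\in X:\operatorname{Lip} f(x)<\infty\}$, $L^\infty(f)=\{x\in X:\operatorname{Lip} f(x)=\infty\}$. A $G_{\delta\sigma}$-set is a countable union of $G_\delta$-sets; an $F_{\sigma\delta}$-set is a countable intersection of $F_\sigma$-sets. *)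

theory Defs
  imports "HOL-Analysis.Analysis"
begin

text \<open>
  Metric spaces are rendered by the library type \<open>'a metric\<close>: a carrier \<open>mspace X\<close> (possibly empty)
  with a distance \<open>mdist X\<close>. The Lipschitz derivatives take values in \<open>ennreal\<close>, where
  \<open>Sup {} = 0\<close>, as the convention on empty suprema requires (e.g. at isolated points).
  They are meaningful for \<open>x \<in> mspace X\<close> and \<open>f\<close> mapping \<open>mspace X\<close> into \<open>mspace Y\<close>.
\<close>

definition big_Lip :: "'a metric \<Rightarrow> 'b metric \<Rightarrow> ('a \<Rightarrow> 'b) \<Rightarrow> 'a \<Rightarrow> ennreal" where
  "big_Lip X Y f x =
    (INF r\<in>{0<..}. SUP u\<in>{u \<in> mspace X. 0 < mdist X u x \<and> mdist X u x < r}.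
       ennreal (mdist Y (f u) (f x) / mdist X u x))"

lemma big_Lip_eq_Limsup:
  "x \<in> mspace X \<Longrightarrow> big_Lip X Y f x = Limsup (atin (mtopology_of X) x) (\<lambda>u. ennreal (mdist Y (f u) (f x) / mdist X u x))"
proof -
  assume x: "x \<in> mspace X"
  let ?g = "\<lambda>u. ennreal (mdist Y (f u) (f x) / mdist X u x)"
  have ev: "eventually P (atin (mtopology_of X) x) \<longleftrightarrow> (\<exists>r>0. \<forall>u. u \<in> mspace X \<and> 0 < mdist X u x \<and> mdist X u x < r \<longrightarrow> P u)" for P
    using x Metric_space.eventually_atin_metric[OF Metric_space_mspace_mdist, of P X x]
    by (auto simp: mtopology_of_def)
  show ?thesis
    unfolding big_Lip_def Limsup_def
  proof (rule antisym)
    show "(INF r\<in>{0<..}. SUP u\<in>{u \<in> mspace X. 0 < mdist X u x \<and> mdist X u x < r}. ?g u) \<le> (INF P\<in>{P. eventually P (atin (mtopology_of X) x)}. SUP u\<in>{x. P x}. ?g u)"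
      by (rule INF_mono) (auto simp: ev intro!: SUP_subset_mono)
    show "(INF P\<in>{P. eventually P (atin (mtopology_of X) x)}. SUP u\<in>{x. P x}. ?g u) \<le> (INF r\<in>{0<..}. SUP u\<in>{u \<in> mspace X. 0 < mdist X u x \<and> mdist X u x < r}. ?g u)"
      apply (rule INF_mono)
      subgoal for r by (rule bexI[of _ "\<lambda>u. u \<in> mspace X \<and> 0 < mdist X u x \<and> mdist X u x < r"]) (auto simp: ev)
      done
  qed
qed

definition little_lip :: "'a metric \<Rightarrow> 'b metric \<Rightarrow> ('a \<Rightarrow> 'b) \<Rightarrow> 'a \<Rightarrow> ennreal" where
  "little_lip X Y f x =
    Liminf (at_right (0::real)) (\<lambda>r. SUP u\<in>mball_of X x r. ennreal (1 / r * mdist Y (f u) (f x)))"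

definition lip_finite :: "'a metric \<Rightarrow> 'b metric \<Rightarrow> ('a \<Rightarrow> 'b) \<Rightarrow> 'a set" where
  "lip_finite X Y f = {x \<in> mspace X. little_lip X Y f x < \<infinity>}"

definition lip_infinite :: "'a metric \<Rightarrow> 'b metric \<Rightarrow> ('a \<Rightarrow> 'b) \<Rightarrow> 'a set" where
  "lip_infinite X Y f = {x \<in> mspace X. little_lip X Y f x = \<infinity>}"

definition Lip_finite :: "'a metric \<Rightarrow> 'b metric \<Rightarrow> ('a \<Rightarrow> 'b) \<Rightarrow> 'a set" where
  "Lip_finite X Y f = {x \<in> mspace X. big_Lip X Y f x < \<infinity>}"

definition Lip_infinite :: "'a metric \<Rightarrow> 'b metric \<Rightarrow> ('a \<Rightarrow> 'b) \<Rightarrow> 'a set" where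
  "Lip_infinite X Y f = {x \<in> mspace X. big_Lip X Y f x = \<infinity>}"

definition gdelta_sigma_in :: "'a topology \<Rightarrow> 'a set \<Rightarrow> bool" where
  "gdelta_sigma_in T = countable union_of gdelta_in T"

text \<open>As in \<open>gdelta_in\<close>, \<open>relative_to\<close> makes the empty intersection the whole space.\<close>

definition fsigma_delta_in :: "'a topology \<Rightarrow> 'a set \<Rightarrow> bool" where
  "fsigma_delta_in T = (countable intersection_of fsigma_in T) relative_to topspace T"

end

theory Submission
  imports Defs
begin

text \<open>
  The set where \<open>f\<close> satisfies \<open>\<bar>f u - f x\<bar> \<le> n \<bar>u - x\<bar>\<close> for all \<open>u \<in> B(x, 1/(n+1))\<close> is closed, and these
  sets exhaust \<open>L(f)\<close>. For \<open>\<ell>(f)\<close> the point is to leave slack: the set of all \<open>x\<close> such that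
  \<open>\<bar>f u - f x\<bar> \<le> c\<close> on \<open>B(x, r)\<close> for some \<open>r < 1/(m+1)\<close> and some \<open>c < n r\<close> is open, since passing to a
  nearby point \<open>y\<close> only shrinks \<open>r\<close> and enlarges \<open>c\<close> by a small amount. Intersecting over \<open>m\<close> and
  taking the union over \<open>n\<close> yields \<open>\<ell>(f)\<close>.
\<close>

definition small_growth_set :: "'a metric \<Rightarrow> 'b metric \<Rightarrow> ('a \<Rightarrow> 'b) \<Rightarrow> real \<Rightarrow> real \<Rightarrow> 'a set" where
  "small_growth_set X Y f K d =
    {x \<in> mspace X. \<exists>r c. 0 < r \<and> r < d \<and> c < K * r \<and> (\<forall>u\<in>mball_of X x r. mdist Y (f u) (f x) \<le> c)}"

definition lipschitz_at_scale :: "'a metric \<Rightarrow> 'b metric \<Rightarrow> ('a \<Rightarrow> 'b) \<Rightarrow> real \<Rightarrow> real \<Rightarrow> 'a set" where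
  "lipschitz_at_scale X Y f K d =
    {x \<in> mspace X. \<forall>u\<in>mspace X. mdist X u x < d \<longrightarrow> mdist Y (f u) (f x) \<le> K * mdist X u x}"

lemma mdist_self: "x \<in> mspace X \<Longrightarrow> mdist X x x = 0"
  by simp

lemma openin_mball_of: "openin (mtopology_of X) (mball_of X x r)"
  by (simp add: mball_of_def mtopology_of_def Metric_space.openin_mball)

text \<open>Membership in the sets below depends on both \<open>x\<close> and \<open>f x\<close>, so
  nearness is measured in both spaces with one common \<open>e\<close>. Continuity makes the points
  that are \<open>e\<close>-near in both senses an open neighbourhood of \<open>x\<close>.\<close>

lemma openin_mtopology_of_continuousI:
  assumes cont: "continuous_map (mtopology_of X) (mtopology_of Y) f"
    and "S \<subseteq> mspace X"
    and near: "\<And>x. x \<in> S \<Longrightarrow> \<exists>e>0. \<forall>y\<in>mspace X. mdist X x y < e \<longrightarrow> mdist Y (f x) (f y) < e \<longrightarrow> y \<in> S"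
  shows "openin (mtopology_of X) S"
proof (subst openin_subopen, intro ballI)
  fix x assume x: "x \<in> S"
  have fY: "f y \<in> mspace Y" if "y \<in> mspace X" for y
    using cont that by (auto simp: continuous_map_def)
  obtain e where e: "e > 0"
    "\<And>y. \<lbrakk>y \<in> mspace X; mdist X x y < e; mdist Y (f x) (f y) < e\<rbrakk> \<Longrightarrow> y \<in> S"
    using near[OF x] by blast
  let ?V = "mball_of X x e \<inter> {y \<in> topspace (mtopology_of X). f y \<in> mball_of Y (f x) e}"
  have "openin (mtopology_of X) ?V"
    by (intro openin_Int openin_mball_of openin_continuous_map_preimage[OF cont])
  moreover have "x \<in> ?V" "?V \<subseteq> S"
    using x e fY subsetD[OF \<open>S \<subseteq> mspace X\<close> x] by (auto simp: mdist_self)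
  ultimately show "\<exists>T. openin (mtopology_of X) T \<and> x \<in> T \<and> T \<subseteq> S"
    by blast
qed

lemma openin_small_growth_set:
  assumes cont: "continuous_map (mtopology_of X) (mtopology_of Y) f" and "K \<ge> 0"
  shows "openin (mtopology_of X) (small_growth_set X Y f K d)"
proof (rule openin_mtopology_of_continuousI[OF cont])
  show "small_growth_set X Y f K d \<subseteq> mspace X"
    by (auto simp: small_growth_set_def)
next
  fix x assume "x \<in> small_growth_set X Y f K d"
  then obtain r c where x: "x \<in> mspace X" and r: "0 < r" "r < d" "c < K * r"
    and c: "\<And>u. u \<in> mball_of X x r \<Longrightarrow> mdist Y (f u) (f x) \<le> c"
    by (auto simp: small_growth_set_def)
  have fY: "f y \<in> mspace Y" if "y \<in> mspace X" for y
    using cont that by (auto simp: continuous_map_def)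
  \<comment> \<open>Moving from \<open>x\<close> to \<open>y\<close> costs \<open>e\<close> twice:
    the radius drops to \<open>r - e\<close> and the bound rises to \<open>c + e\<close>. The new
    slack \<open>c + e < K * (r - e)\<close> amounts to \<open>e * (K + 1) < K * r - c\<close>; the
    factor 2 makes it strict, and \<open>r / 2\<close> keeps the new radius positive.\<close>
  define e where "e = min (r / 2) ((K * r - c) / (2 * (K + 1)))"
  have e: "e > 0" "e \<le> r / 2"
    unfolding e_def using r \<open>K \<ge> 0\<close> by (simp, intro min.cobounded1)
  have "e * (2 * (K + 1)) \<le> K * r - c"
    using \<open>K \<ge> 0\<close> by (simp add: e_def pos_le_divide_eq[symmetric])
  with e r \<open>K \<ge> 0\<close> have slack: "c + e < K * (r - e)"
    by (simp add: algebra_simps)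
  have "y \<in> small_growth_set X Y f K d"
    if y: "y \<in> mspace X" "mdist X x y < e" "mdist Y (f x) (f y) < e" for y
  proof -
    have "mdist Y (f u) (f y) \<le> c + e" if "u \<in> mball_of X y (r - e)" for u
    proof -
      have u: "u \<in> mspace X" "mdist X y u < r - e"
        using that by auto
      have "mdist X x u < r"
        using mdist_triangle[OF x y(1) u(1)] u(2) y(2) by linarith
      then have "mdist Y (f u) (f x) \<le> c"
        using x u by (intro c) auto
      then show ?thesis
        using mdist_triangle[OF fY[OF u(1)] fY[OF x] fY[OF y(1)]] y(3) by linarith
    qed
    then show ?thesis
      unfolding small_growth_set_def using y(1) e r slack
      by (intro CollectI conjI exI[of _ "r - e"] exI[of _ "c + e"]) auto
  qed
  with e(1) show "\<exists>e>0. \<forall>y\<in>mspace X. mdist X x y < e \<longrightarrow> mdist Y (f x) (f y) < e \<longrightarrow> y \<in> small_growth_set X Y f K d"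
    by blast
qed

text \<open>Failure at \<open>x\<close> is witnessed by a single \<open>u\<close> through two strict
  inequalities. Both survive a small move of \<open>x\<close> with \<open>u\<close> kept fixed, so
  the complement is open.\<close>

lemma closedin_lipschitz_at_scale:
  assumes cont: "continuous_map (mtopology_of X) (mtopology_of Y) f" and "K \<ge> 0"
  shows "closedin (mtopology_of X) (lipschitz_at_scale X Y f K d)"
proof -
  have fY: "f y \<in> mspace Y" if "y \<in> mspace X" for y
    using cont that by (auto simp: continuous_map_def)
  have "openin (mtopology_of X) (mspace X - lipschitz_at_scale X Y f K d)"
  proof (rule openin_mtopology_of_continuousI[OF cont])
    fix x assume "x \<in> mspace X - lipschitz_at_scale X Y f K d"
    then obtain u where x: "x \<in> mspace X" and u: "u \<in> mspace X" "mdist X u x < d"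
      "K * mdist X u x < mdist Y (f u) (f x)"
      by (auto simp: lipschitz_at_scale_def not_le)
    \<comment> \<open>The first term keeps \<open>u\<close> within distance \<open>d\<close> of
      \<open>y\<close>. The second absorbs a loss of \<open>e\<close> in Y and a gain of
      \<open>K * e\<close> on the right; strictness comes from
      \<open>mdist Y (f x) (f y) < e\<close>.\<close>
    define e where "e = min (d - mdist X u x) ((mdist Y (f u) (f x) - K * mdist X u x) / (K + 1))"
    have e: "e > 0" "e \<le> d - mdist X u x"
      using u \<open>K \<ge> 0\<close> by (auto simp: e_def)
    have slack: "e * (K + 1) \<le> mdist Y (f u) (f x) - K * mdist X u x"
      using \<open>K \<ge> 0\<close> by (simp add: e_def pos_le_divide_eq[symmetric])
    have "y \<in> mspace X - lipschitz_at_scale X Y f K d"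
      if y: "y \<in> mspace X" "mdist X x y < e" "mdist Y (f x) (f y) < e" for y
    proof -
      have uy: "mdist X u y < mdist X u x + e"
        using mdist_triangle[OF u(1) x y(1)] y(2) by linarith
      have "mdist Y (f u) (f x) < mdist Y (f u) (f y) + e"
        using mdist_triangle[OF fY[OF u(1)] fY[OF y(1)] fY[OF x]] y(3)
        by (simp add: mdist_commute)
      moreover have "K * mdist X u y \<le> K * (mdist X u x + e)"
        using uy \<open>K \<ge> 0\<close> by (intro mult_left_mono) auto
      ultimately have "K * mdist X u y < mdist Y (f u) (f y)"
        using slack by (simp add: algebra_simps)
      then show ?thesis
        using y(1) u(1) uy e(2) by (force simp: lipschitz_at_scale_def)
    qed
    with e(1) show "\<exists>e>0. \<forall>y\<in>mspace X. mdist X x y < e \<longrightarrow> mdist Y (f x) (f y) < e \<longrightarrow> y \<in> mspace X - lipschitz_at_scale X Y f K d"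
      by blast
  qed auto
  then show ?thesis
    by (auto simp: closedin_def lipschitz_at_scale_def)
qed

lemma little_lip_less_top_iff:
  assumes "x \<in> mspace X"
  shows "little_lip X Y f x < \<infinity> \<longleftrightarrow>
    (\<exists>n. \<forall>m. x \<in> small_growth_set X Y f (real n) (1 / real (Suc m)))" (is "?L \<longleftrightarrow> ?R")
proof
  let ?g = "\<lambda>r. SUP u\<in>mball_of X x r. ennreal (1 / r * mdist Y (f u) (f x))"
  assume ?L
  then obtain n :: nat where n: "little_lip X Y f x < of_nat n"
    using ennreal_Ex_less_of_nat by auto
  have "x \<in> small_growth_set X Y f (real n) (1 / real (Suc m))" for m
  proof -
    \<comment> \<open>Otherwise the liminf would be at least \<open>n\<close>. Hence
      \<open>?g r < n\<close> for arbitrarily small \<open>r\<close>, in particular for one below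
      \<open>1 / (m + 1)\<close>.\<close>
    have "\<not> eventually (\<lambda>r. of_nat n \<le> ?g r) (at_right (0::real))"
      using n Liminf_bounded[of "of_nat n" ?g "at_right (0::real)"]
      by (auto simp: little_lip_def not_le[symmetric])
    then obtain r where r: "0 < r" "r < 1 / real (Suc m)" "?g r < of_nat n"
      unfolding eventually_at_right_field not_ex not_all not_le
      by (metis not_le of_nat_0_less_iff zero_less_Suc zero_less_divide_1_iff)
    \<comment> \<open>The supremum is finite, being below \<open>n\<close>, so its real value
      \<open>s\<close> gives the witness \<open>c = s * r\<close>; the strict \<open>s < n\<close>
      is what provides the slack \<open>c < n * r\<close>.\<close>
    define s where "s = enn2real (?g r)"
    have s: "?g r = ennreal s" "0 \<le> s"
      unfolding s_def using less_trans[OF r(3) of_nat_less_top] by simp_all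
    have "s < real n"
      using r(3) s by (simp add: ennreal_of_nat_eq_real_of_nat ennreal_less_iff)
    moreover have "mdist Y (f u) (f x) \<le> s * r" if "u \<in> mball_of X x r" for u
    proof -
      have "ennreal (1 / r * mdist Y (f u) (f x)) \<le> ennreal s"
        unfolding s(1)[symmetric] using that by (rule SUP_upper)
      then show ?thesis
        using s(2) r(1) by (simp add: ennreal_le_iff pos_divide_le_eq)
    qed
    ultimately show ?thesis
      using assms r unfolding small_growth_set_def
      by (intro CollectI conjI exI[of _ r] exI[of _ "s * r"]) auto
  qed
  then show ?R by blast
next
  let ?g = "\<lambda>r. SUP u\<in>mball_of X x r. ennreal (1 / r * mdist Y (f u) (f x))"
  assume ?R
  then obtain n where n: "\<And>m. x \<in> small_growth_set X Y f (real n) (1 / real (Suc m))"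
    by blast
  have "little_lip X Y f x \<le> of_nat n"
  proof (rule ccontr)
    assume "\<not> ?thesis"
    \<comment> \<open>A liminf above \<open>n\<close> would force \<open>?g r > n\<close> on a whole
      interval \<open>(0, b)\<close>, but a scale \<open>1 / (m + 1) < b\<close> supplies a radius
      there with \<open>?g r \<le> n\<close>.\<close>
    then have "eventually (\<lambda>r. of_nat n < ?g r) (at_right (0::real))"
      unfolding little_lip_def not_le by (rule less_LiminfD)
    then obtain b where b: "b > 0" "\<And>r. 0 < r \<Longrightarrow> r < b \<Longrightarrow> of_nat n < ?g r"
      by (auto simp: eventually_at_right_field)
    obtain m where "1 / real (Suc m) < b"
      using nat_approx_posE[OF b(1)] by blast
    moreover obtain r c where r: "0 < r" "r < 1 / real (Suc m)" "c < real n * r"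
      and c: "\<And>u. u \<in> mball_of X x r \<Longrightarrow> mdist Y (f u) (f x) \<le> c"
      using n[of m] by (auto simp: small_growth_set_def)
    ultimately have "of_nat n < ?g r"
      by (intro b(2)) auto
    moreover have "?g r \<le> of_nat n"
    proof (rule SUP_least)
      fix u assume "u \<in> mball_of X x r"
      then have "mdist Y (f u) (f x) \<le> real n * r"
        using c r(3) by force
      then show "ennreal (1 / r * mdist Y (f u) (f x)) \<le> of_nat n"
        using r(1) by (simp add: ennreal_of_nat_eq_real_of_nat pos_divide_le_eq)
    qed
    ultimately show False by simp
  qed
  then show ?L
    by (simp add: order.strict_trans1[OF _ of_nat_less_top])
qed

text \<open>One index can serve as both constant and scale: raising \<open>n\<close> weakens the
  bound and shrinks the ball, so a constant \<open>k\<close> and a scale index \<open>m\<close> are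
  merged into their maximum.\<close>

lemma big_Lip_less_top_iff:
  assumes "x \<in> mspace X" "f x \<in> mspace Y"
  shows "big_Lip X Y f x < \<infinity> \<longleftrightarrow>
    (\<exists>n. x \<in> lipschitz_at_scale X Y f (real n) (1 / real (Suc n)))" (is "?L \<longleftrightarrow> ?R")
proof
  let ?A = "\<lambda>r. {u \<in> mspace X. 0 < mdist X u x \<and> mdist X u x < r}"
  let ?g = "\<lambda>u. ennreal (mdist Y (f u) (f x) / mdist X u x)"
  assume ?L
  then obtain r where r: "r > 0" "(SUP u\<in>?A r. ?g u) < \<infinity>"
    by (auto simp: big_Lip_def INF_less_iff)
  then obtain k :: nat where k: "(SUP u\<in>?A r. ?g u) < of_nat k"
    using ennreal_Ex_less_of_nat by auto
  obtain m where m: "1 / real (Suc m) < r"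
    using nat_approx_posE[OF r(1)] by blast
  define n where "n = max k m"
  have "1 / real (Suc n) \<le> 1 / real (Suc m)"
    by (auto simp: n_def intro!: divide_left_mono)
  with m have nr: "1 / real (Suc n) < r" by linarith
  have "mdist Y (f u) (f x) \<le> real n * mdist X u x"
    if u: "u \<in> mspace X" "mdist X u x < 1 / real (Suc n)" for u
  \<comment> \<open>The supremum omits \<open>u = x\<close>, whereas
    \<open>lipschitz_at_scale\<close> includes it; there both sides are 0.\<close>
  proof (cases "u = x")
    case True
    then show ?thesis using assms by (simp add: mdist_self)
  next
    case False
    then have pos: "0 < mdist X u x"
      using u(1) assms by (simp add: less_le)
    have "?g u \<le> (SUP u\<in>?A r. ?g u)"
      using u nr pos by (intro SUP_upper) auto
    also have "\<dots> \<le> of_nat k" using k by simp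
    also have "\<dots> \<le> of_nat n" by (simp add: n_def)
    finally show ?thesis
      using pos by (simp add: ennreal_of_nat_eq_real_of_nat pos_divide_le_eq)
  qed
  then show ?R
    using assms by (auto simp: lipschitz_at_scale_def)
next
  assume ?R
  then obtain n where n: "\<And>u. \<lbrakk>u \<in> mspace X; mdist X u x < 1 / real (Suc n)\<rbrakk>
      \<Longrightarrow> mdist Y (f u) (f x) \<le> real n * mdist X u x"
    by (auto simp: lipschitz_at_scale_def)
  have "big_Lip X Y f x \<le> of_nat n"
    unfolding big_Lip_def
    \<comment> \<open>If \<open>x\<close> is isolated at this scale, the supremum is over the empty
      set and equals 0, so the bound still holds.\<close>
    by (rule INF_lower2[of "1 / real (Suc n)"])
      (auto intro!: SUP_least n simp: ennreal_of_nat_eq_real_of_nat pos_divide_le_eq)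
  then show ?L
    by (simp add: order.strict_trans1[OF _ of_nat_less_top])
qed

lemma gdelta_in_INT_openin:
  assumes "\<And>n::nat. openin T (U n)"
  shows "gdelta_in T (\<Inter>n. U n)"
  using assms by (intro gdelta_in_Inter) (auto simp: open_imp_gdelta_in)

theorem corollary5p6:
  fixes X :: "'a metric" and Y :: "'b metric" and f :: "'a \<Rightarrow> 'b"
  assumes "continuous_map (mtopology_of X) (mtopology_of Y) f"
  shows "gdelta_sigma_in (mtopology_of X) (lip_finite X Y f)
    \<and> fsigma_delta_in (mtopology_of X) (lip_infinite X Y f)
    \<and> fsigma_in (mtopology_of X) (Lip_finite X Y f)
    \<and> gdelta_in (mtopology_of X) (Lip_infinite X Y f)"
proof (intro conjI)
  let ?T = "mtopology_of X"
  define G where "G = (\<lambda>n. \<Inter>m. small_growth_set X Y f (real n) (1 / real (Suc m)))"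
  have G: "gdelta_in ?T (G n)" for n
    unfolding G_def by (intro gdelta_in_INT_openin openin_small_growth_set assms) auto
  have lip: "lip_finite X Y f = (\<Union>n. G n)"
    using little_lip_less_top_iff[of _ X Y f]
    by (auto simp: lip_finite_def G_def) (auto simp: small_growth_set_def)
  show "gdelta_sigma_in ?T (lip_finite X Y f)"
    unfolding gdelta_sigma_in_def union_of_def lip
    by (rule exI[of _ "range G"]) (auto simp: G)
  \<comment> \<open>De Morgan applied to the union of the \<open>G n\<close>; the outer intersection
    with \<open>topspace ?T\<close> gives the form that \<open>relative_to\<close> asks for.\<close>
  have "lip_infinite X Y f = topspace ?T \<inter> (\<Inter>n. topspace ?T - G n)"
    using lip by (auto simp: lip_infinite_def lip_finite_def less_top[symmetric])
  moreover have "(countable intersection_of fsigma_in ?T) (\<Inter>n. topspace ?T - G n)"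
    unfolding intersection_of_def
    by (rule exI[of _ "range (\<lambda>n. topspace ?T - G n)"])
      (use G in \<open>auto intro!: fsigma_in_diff simp del: topspace_mtopology_of\<close>)
  ultimately show "fsigma_delta_in ?T (lip_infinite X Y f)"
    unfolding fsigma_delta_in_def relative_to_def by blast
  have Lip: "Lip_finite X Y f = (\<Union>n. lipschitz_at_scale X Y f (real n) (1 / real (Suc n)))"
    using big_Lip_less_top_iff[of _ X f Y] continuous_map_funspace[OF assms]
    by (auto simp: Lip_finite_def Pi_iff) (auto simp: lipschitz_at_scale_def)
  show L: "fsigma_in ?T (Lip_finite X Y f)"
    unfolding Lip
    by (intro fsigma_in_Union) (auto intro!: closed_imp_fsigma_in closedin_lipschitz_at_scale assms)
  have "Lip_infinite X Y f = topspace ?T - Lip_finite X Y f"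
    by (auto simp: Lip_infinite_def Lip_finite_def less_top[symmetric])
  then show "gdelta_in ?T (Lip_infinite X Y f)"
    using gdelta_in_diff[OF gdelta_in_topspace L] by simp
qed

end
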